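(* Let $\rho>0$, let $x\in\mathbb{R}^n$ have nonnegative entries, and let $A_{\rho,x}:=2ee^\top-\rho xx^\top$, where $e\in\mathbb{R}^n$ is the all-ones vector. The following statements hold. (i) Assume $x=\alpha e$ for some $\alpha>0$. Then $A_{\rho,x}$ has only zero as its eigenvalues if $\rho\alpha^2=2$; otherwise it has $(2-\rho\alpha^2)n$ as its only nonzero eigenvalue, with $\frac{1}{\sqrt n}e$ the corresponding eigenvector. (ii) Assume $x\neq\alpha e$ for any $\alpha\in\mathbb{R}$. Then $A_{\rho,x}$ has only one positive eigenvalue $\overline\lambda$ and one negative eigenvalue $\underline\lambda$, given by $\overline\lambda=2n-\underline\alpha$ and $\underline\lambda=2n-\overline\alpha$. The corresponding eigenvectors associated with $\overline\lambda$ and $\underline\lambda$ are $\overline w=x-\frac{\overline\alpha}{\rho\|x\|_1}e$ and $\underline w=x-\frac{\underline\alpha}{\rho\|x\|_1}e$, respectively.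
   Context: Here $\Delta:=\left(\frac{\rho}{2}\|x\|_2^2+n\right)^2-2\rho\|x\|_1^2$, $\underline\alpha:=\left(\frac{\rho}{2}\|x\|_2^2+n\right)-\sqrt{\Delta}$ and $\overline\alpha:=\left(\frac{\rho}{2}\|x\|_2^2+n\right)+\sqrt{\Delta}$. *)

theory Defs
  imports Complex_Main "Jordan_Normal_Form.Char_Poly"
begin

definition ones_vec :: "nat \<Rightarrow> real vec" where
  "ones_vec n = vec n (\<lambda>_. 1)"

definition outer_prod :: "real vec \<Rightarrow> real vec \<Rightarrow> real mat" where
  "outer_prod v w = mat (dim_vec v) (dim_vec w) (\<lambda>(i, j). v $ i * w $ j)"

definition l1_norm :: "real vec \<Rightarrow> real" where
  "l1_norm x = (\<Sum>i<dim_vec x. \<bar>x $ i\<bar>)"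

definition l2_norm :: "real vec \<Rightarrow> real" where
  "l2_norm x = sqrt (\<Sum>i<dim_vec x. (x $ i)\<^sup>2)"

definition A_mat :: "real \<Rightarrow> real vec \<Rightarrow> real mat" where
  "A_mat \<rho> x =
     2 \<cdot>\<^sub>m outer_prod (ones_vec (dim_vec x)) (ones_vec (dim_vec x)) - \<rho> \<cdot>\<^sub>m outer_prod x x"

(* For every rho > 0 the discriminant below is nonnegative by Cauchy-Schwarz and AM-GM,
   so its sqrt is the usual one. *)
definition Delta :: "real \<Rightarrow> real vec \<Rightarrow> real" where
  "Delta \<rho> x = (\<rho> / 2 * (l2_norm x)\<^sup>2 + real (dim_vec x))\<^sup>2 - 2 * \<rho> * (l1_norm x)\<^sup>2"

definition alpha_lower :: "real \<Rightarrow> real vec \<Rightarrow> real" where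
  "alpha_lower \<rho> x = (\<rho> / 2 * (l2_norm x)\<^sup>2 + real (dim_vec x)) - sqrt (Delta \<rho> x)"

definition alpha_upper :: "real \<Rightarrow> real vec \<Rightarrow> real" where
  "alpha_upper \<rho> x = (\<rho> / 2 * (l2_norm x)\<^sup>2 + real (dim_vec x)) + sqrt (Delta \<rho> x)"

end

theory Submission
  imports Defs
begin

text \<open>
  On the span of \<open>x\<close> and \<open>e\<close>, which contains every eigenvector for a nonzero eigenvalue, the
  equation \<open>A (a x + b e) = k (a x + b e)\<close> reads \<open>k a = - \<rho> (a q + b s)\<close>, \<open>k b = 2 (a s + b n)\<close>
  with \<open>s = \<parallel>x\<parallel>\<^sub>1\<close> and \<open>q = \<parallel>x\<parallel>\<^sub>2\<^sup>2\<close>.  If \<open>x\<close> and \<open>e\<close> are independent, this forces \<open>a \<noteq> 0\<close>,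
  \<open>b = - a (k + \<rho> q) / (\<rho> s)\<close> and \<open>(k + \<rho> q) (2 n - k) = 2 \<rho> s\<^sup>2\<close>.  The two roots of this
  quadratic have product \<open>2 \<rho> (s\<^sup>2 - n q)\<close>, which is negative by the strict Cauchy-Schwarz
  inequality.
\<close>

lemma A_mat_carrier: "x \<in> carrier_vec n \<Longrightarrow> A_mat \<rho> x \<in> carrier_mat n n"
  unfolding A_mat_def outer_prod_def ones_vec_def by auto

lemma A_mat_mult_vec_index:
  assumes "x \<in> carrier_vec n" and "v \<in> carrier_vec n" and "i < n"
  shows "(A_mat \<rho> x *\<^sub>v v) $ i = 2 * (\<Sum>j<n. v $ j) - \<rho> * (\<Sum>j<n. x $ j * v $ j) * x $ i"
proof -
  have "(A_mat \<rho> x *\<^sub>v v) $ i = (\<Sum>j<n. (2 - \<rho> * (x $ i * x $ j)) * v $ j)"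
    using assms unfolding A_mat_def outer_prod_def ones_vec_def
    by (simp add: scalar_prod_def lessThan_atLeast0)
  also have "\<dots> = (\<Sum>j<n. 2 * v $ j - \<rho> * x $ i * (x $ j * v $ j))"
    by (simp add: algebra_simps)
  also have "\<dots> = 2 * (\<Sum>j<n. v $ j) - \<rho> * (\<Sum>j<n. x $ j * v $ j) * x $ i"
    by (simp add: sum_subtractf sum_distrib_left mult_ac)
  finally show ?thesis .
qed

text \<open>The matrix enters only through two numbers, the sum of \<open>v\<close> and its inner
  product with \<open>x\<close>. For \<open>k \<noteq> 0\<close> each entry of \<open>v\<close> is
  thus one fixed affine function of the same entry of \<open>x\<close>, which is what both cases
  exploit.\<close>

lemma eigenvector_A_mat_iff:
  assumes "x \<in> carrier_vec n"
  shows "eigenvector (A_mat \<rho> x) v k \<longleftrightarrow> v \<in> carrier_vec n \<and> v \<noteq> 0\<^sub>v n \<and>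
    (\<forall>i<n. 2 * (\<Sum>j<n. v $ j) - \<rho> * (\<Sum>j<n. x $ j * v $ j) * x $ i = k * v $ i)"
proof -
  have "A_mat \<rho> x *\<^sub>v v = k \<cdot>\<^sub>v v \<longleftrightarrow>
      (\<forall>i<n. 2 * (\<Sum>j<n. v $ j) - \<rho> * (\<Sum>j<n. x $ j * v $ j) * x $ i = k * v $ i)"
    if "v \<in> carrier_vec n"
    using that A_mat_mult_vec_index[OF assms that] A_mat_carrier[OF assms, of \<rho>]
    by (auto simp: vec_eq_iff simp del: index_mult_mat_vec)
  then show ?thesis
    using A_mat_carrier[OF assms, of \<rho>] unfolding eigenvector_def by auto
qed

text \<open>Strict Cauchy-Schwarz against the all-ones vector, obtained as positivity of a variance:
  the squared deviations from the mean \<open>m\<close> include a nonzero one.\<close>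

lemma sum_power2_less_if_not_constant:
  fixes f :: "nat \<Rightarrow> real"
  assumes "n > 0" and nc: "\<nexists>\<alpha>. \<forall>i<n. f i = \<alpha>"
  shows "(\<Sum>i<n. f i)\<^sup>2 < real n * (\<Sum>i<n. (f i)\<^sup>2)"
proof -
  define m where "m = (\<Sum>i<n. f i) / real n"
  obtain i where i: "i < n" "f i \<noteq> m" using nc by blast
  have s: "(\<Sum>i<n. f i) = real n * m" using assms(1) by (simp add: m_def)
  have "0 < (\<Sum>i<n. (f i - m)\<^sup>2)"
    using i by (intro sum_pos2[of _ i]) auto
  also have "\<dots> = (\<Sum>i<n. (f i)\<^sup>2 - 2 * m * f i + m\<^sup>2)"
    by (simp add: power2_diff algebra_simps)
  also have "\<dots> = (\<Sum>i<n. (f i)\<^sup>2) - real n * m\<^sup>2"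
    by (simp add: sum.distrib sum_subtractf sum_distrib_left[symmetric] s power2_eq_square)
  finally have "0 < real n * ((\<Sum>i<n. (f i)\<^sup>2) - real n * m\<^sup>2)" using assms(1) by simp
  then show ?thesis by (simp add: s power2_eq_square algebra_simps)
qed

lemma eigenvector_A_mat_const_iff:
  assumes "n > 0" and "x = \<alpha> \<cdot>\<^sub>v ones_vec n"
  shows "eigenvector (A_mat \<rho> x) v k \<longleftrightarrow> v \<in> carrier_vec n \<and> v \<noteq> 0\<^sub>v n \<and>
    (\<forall>i<n. (2 - \<rho> * \<alpha>\<^sup>2) * (\<Sum>j<n. v $ j) = k * v $ i)"
proof -
  have x: "x \<in> carrier_vec n" and xi: "\<And>i. i < n \<Longrightarrow> x $ i = \<alpha>"
    using assms(2) by (auto simp: ones_vec_def)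
  have "(\<Sum>j<n. x $ j * v $ j) = \<alpha> * (\<Sum>j<n. v $ j)"
    by (simp add: xi sum_distrib_left)
  then show ?thesis
    unfolding eigenvector_A_mat_iff[OF x] by (simp add: xi power2_eq_square algebra_simps)
qed

text \<open>Dividing by \<open>k\<close> shows that all entries of \<open>v\<close> agree;
  substituting their common value back into the equation determines \<open>k\<close>.\<close>

lemma eigenvector_A_mat_const_nonzero_iff:
  assumes n: "n > 0" and x: "x = \<alpha> \<cdot>\<^sub>v ones_vec n" and k: "k \<noteq> 0"
  shows "eigenvector (A_mat \<rho> x) v k \<longleftrightarrow>
    k = (2 - \<rho> * \<alpha>\<^sup>2) * real n \<and> (\<exists>c. c \<noteq> 0 \<and> v = c \<cdot>\<^sub>v ones_vec n)"
proof
  assume "eigenvector (A_mat \<rho> x) v k"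
  then have v: "v \<in> carrier_vec n" "v \<noteq> 0\<^sub>v n"
    and ev: "\<And>i. i < n \<Longrightarrow> (2 - \<rho> * \<alpha>\<^sup>2) * (\<Sum>j<n. v $ j) = k * v $ i"
    unfolding eigenvector_A_mat_const_iff[OF n x] by auto
  define c where "c = (2 - \<rho> * \<alpha>\<^sup>2) * (\<Sum>j<n. v $ j) / k"
  have vi: "v $ i = c" if "i < n" for i
    using ev[OF that] k by (simp add: c_def field_simps)
  have vc: "v = c \<cdot>\<^sub>v ones_vec n" using v(1) vi by (intro eq_vecI) (auto simp: ones_vec_def)
  have c: "c \<noteq> 0" using vc v(2) by (auto simp: ones_vec_def)
  have "(\<Sum>j<n. v $ j) = real n * c" by (simp add: vi)
  \<comment> \<open>Both facts are taken at index 0, which exists because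
    \<open>n > 0\<close>.\<close>
  then have "k = (2 - \<rho> * \<alpha>\<^sup>2) * real n" using ev[OF n] vi[OF n] c by simp
  with vc c show "k = (2 - \<rho> * \<alpha>\<^sup>2) * real n \<and> (\<exists>c. c \<noteq> 0 \<and> v = c \<cdot>\<^sub>v ones_vec n)" by blast
next
  assume "k = (2 - \<rho> * \<alpha>\<^sup>2) * real n \<and> (\<exists>c. c \<noteq> 0 \<and> v = c \<cdot>\<^sub>v ones_vec n)"
  then obtain c where k': "k = (2 - \<rho> * \<alpha>\<^sup>2) * real n" and c: "c \<noteq> 0"
    and v: "v = c \<cdot>\<^sub>v ones_vec n" by blast
  have vi: "v $ i = c" if "i < n" for i using that by (simp add: v ones_vec_def)
  have "v \<noteq> 0\<^sub>v n" using vi[OF n] c n by auto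
  then show "eigenvector (A_mat \<rho> x) v k"
    unfolding eigenvector_A_mat_const_iff[OF n x] by (simp add: vi k') (simp add: v ones_vec_def)
qed

text \<open>The quadratic is the compatibility condition of the two coefficient equations on the
  span of \<open>x\<close> and the all-ones vector. Eigenvectors are scaled by their coefficient at
  \<open>x\<close>, and \<open>s \<noteq> 0\<close> allows solving for the other one.\<close>

lemma eigenvector_A_mat_nonconst_iff:
  fixes k :: real
  assumes x: "x \<in> carrier_vec n" and nc: "\<And>\<alpha>. x \<noteq> \<alpha> \<cdot>\<^sub>v ones_vec n"
    and s: "s = (\<Sum>i<n. x $ i)" "s \<noteq> 0" and q: "q = (\<Sum>i<n. (x $ i)\<^sup>2)"
    and \<rho>: "\<rho> \<noteq> 0" and k: "k \<noteq> 0"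
  shows "eigenvector (A_mat \<rho> x) v k \<longleftrightarrow>
    (k + \<rho> * q) * (2 * real n - k) = 2 * \<rho> * s\<^sup>2 \<and>
    (\<exists>c. c \<noteq> 0 \<and> v = c \<cdot>\<^sub>v (x - ((k + \<rho> * q) / (\<rho> * s)) \<cdot>\<^sub>v ones_vec n))"
    (is "?L \<longleftrightarrow> ?Q \<and> ?R")
proof -
  \<comment> \<open>Stated for arbitrary coefficients since both directions need it: first with
    those extracted from an eigenvector, then with \<open>c\<close> and
    \<open>- c * t\<close>.\<close>
  have S: "(\<Sum>j<n. v $ j) = a * s + b * real n"
    and X: "(\<Sum>j<n. x $ j * v $ j) = a * q + b * s"
    if "\<And>i. i < n \<Longrightarrow> v $ i = a * x $ i + b" for a b
  proof -
    show "(\<Sum>j<n. v $ j) = a * s + b * real n"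
      by (simp add: that sum.distrib sum_distrib_left s)
    have "(\<Sum>j<n. x $ j * v $ j) = (\<Sum>j<n. a * (x $ j)\<^sup>2 + b * x $ j)"
      by (intro sum.cong) (auto simp: that power2_eq_square algebra_simps)
    then show "(\<Sum>j<n. x $ j * v $ j) = a * q + b * s"
      by (simp add: sum.distrib sum_distrib_left s q)
  qed
  show ?thesis
  proof
    assume ?L
    then have v: "v \<in> carrier_vec n" "v \<noteq> 0\<^sub>v n"
      and ev: "\<And>i. i < n \<Longrightarrow>
        2 * (\<Sum>j<n. v $ j) - \<rho> * (\<Sum>j<n. x $ j * v $ j) * x $ i = k * v $ i"
      unfolding eigenvector_A_mat_iff[OF x] by auto
    define a where "a = - \<rho> * (\<Sum>j<n. x $ j * v $ j) / k"
    define b where "b = 2 * (\<Sum>j<n. v $ j) / k"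
    have vi: "v $ i = a * x $ i + b" if "i < n" for i
      using ev[OF that] k by (simp add: a_def b_def field_simps)
    have "(\<Sum>j<n. x $ j * v $ j) = a * q + b * s" and "(\<Sum>j<n. v $ j) = a * s + b * real n"
      using X[of a b] S[of a b] vi by blast+
    note sums = this
    have ka: "k * a = - \<rho> * (a * q + b * s)"
      and kb: "k * b = 2 * (a * s + b * real n)"
      unfolding sums[symmetric] using k by (simp_all add: a_def b_def)
    have b: "b = - a * ((k + \<rho> * q) / (\<rho> * s))"
      using ka \<rho> s(2) by (simp add: field_simps)
    have a: "a \<noteq> 0"
    proof
      assume "a = 0"
      then have "v = 0\<^sub>v n" using v(1) vi b by (intro eq_vecI) auto
      with v(2) show False by simp
    qed
    have an: "a * (k + \<rho> * q) = - \<rho> * s * b" and bn: "b * (2 * real n - k) = - 2 * s * a"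
      using ka kb by (simp_all add: algebra_simps)
    \<comment> \<open>Multiplying \<open>an\<close> by \<open>2 * real n - k\<close> lets
      \<open>bn\<close> eliminate \<open>b\<close>; the common factor \<open>a\<close> then
      cancels.\<close>
    have "a * ((k + \<rho> * q) * (2 * real n - k)) = - \<rho> * s * (b * (2 * real n - k))"
      unfolding mult.assoc[symmetric] an ..
    also have "\<dots> = a * (2 * \<rho> * s\<^sup>2)"
      unfolding bn by (simp add: power2_eq_square)
    finally have "a * ((k + \<rho> * q) * (2 * real n - k)) = a * (2 * \<rho> * s\<^sup>2)" .
    then have ?Q using a by simp
    moreover have "v = a \<cdot>\<^sub>v (x - ((k + \<rho> * q) / (\<rho> * s)) \<cdot>\<^sub>v ones_vec n)"
      using v(1) x by (intro eq_vecI) (auto simp: ones_vec_def vi b right_diff_distrib)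
    ultimately show "?Q \<and> ?R" using a by blast
  next
    assume "?Q \<and> ?R"
    then obtain c where Q: ?Q and c: "c \<noteq> 0"
      and v: "v = c \<cdot>\<^sub>v (x - ((k + \<rho> * q) / (\<rho> * s)) \<cdot>\<^sub>v ones_vec n)" by blast
    define t where "t = (k + \<rho> * q) / (\<rho> * s)"
    have vi: "v $ i = c * x $ i + - c * t" if "i < n" for i
      using that x by (simp add: v ones_vec_def t_def right_diff_distrib)
    have vn: "v \<in> carrier_vec n" using x by (simp add: v ones_vec_def)
    have v0: "v \<noteq> 0\<^sub>v n"
    proof
      assume "v = 0\<^sub>v n"
      then have "x $ i = t" if "i < n" for i using vi[OF that] that c by simp
      then have "x = t \<cdot>\<^sub>v ones_vec n" using x by (intro eq_vecI) (auto simp: ones_vec_def)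
      with nc show False by blast
    qed
    have t: "\<rho> * s * t = k + \<rho> * q" using \<rho> s(2) by (simp add: t_def)
    \<comment> \<open>In terms of \<open>t\<close>, the quadratic is \<open>\<rho> * s\<close> times
      the second coefficient equation.\<close>
    have "\<rho> * s * (t * (2 * real n - k)) = \<rho> * s * (2 * s)"
      unfolding mult.assoc[symmetric] t Q by (simp add: power2_eq_square)
    then have t2: "t * (2 * real n - k) = 2 * s" using \<rho> s(2) by simp
    \<comment> \<open>An identity of affine polynomials in \<open>y\<close>, to be used at
      \<open>y = x $ i\<close>: \<open>t2\<close> matches the constant terms and \<open>t\<close>
      the coefficients of \<open>y\<close>.\<close>
    have ev: "2 * (c * s + - c * t * real n) - \<rho> * (c * q + - c * t * s) * y = k * (c * y + - c * t)"
      for y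
    proof -
      have "2 * (c * s + - c * t * real n) - \<rho> * (c * q + - c * t * s) * y =
          c * (2 * s - 2 * (t * real n)) + c * y * (\<rho> * s * t - \<rho> * q)"
        by (simp add: algebra_simps)
      also have "2 * s - 2 * (t * real n) = - (k * t)"
        using t2 by (simp add: algebra_simps)
      also have "\<rho> * s * t - \<rho> * q = k" using t by simp
      finally show ?thesis by (simp add: algebra_simps)
    qed
    have sums: "(\<Sum>j<n. x $ j * v $ j) = c * q + - c * t * s"
        "(\<Sum>j<n. v $ j) = c * s + - c * t * real n"
      using X[of c "- c * t"] S[of c "- c * t"] vi by blast+
    show ?L
      unfolding eigenvector_A_mat_iff[OF x] unfolding sums using vn v0 ev vi by simp
  qed
qed

theorem proposition3p5:
  fixes n :: nat and \<rho> :: real and x :: "real vec"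
  assumes "n > 0" and "\<rho> > 0"
    and "x \<in> carrier_vec n" and "\<forall>i<n. x $ i \<ge> 0"
  shows
    "(\<forall>\<alpha>>0. x = \<alpha> \<cdot>\<^sub>v ones_vec n \<longrightarrow>
        (\<rho> * \<alpha>\<^sup>2 = 2 \<longrightarrow> {k. eigenvalue (A_mat \<rho> x) k} = {0}) \<and>
        (\<rho> * \<alpha>\<^sup>2 \<noteq> 2 \<longrightarrow>
          {k. eigenvalue (A_mat \<rho> x) k \<and> k \<noteq> 0} = {(2 - \<rho> * \<alpha>\<^sup>2) * real n} \<and>
          {v. eigenvector (A_mat \<rho> x) v ((2 - \<rho> * \<alpha>\<^sup>2) * real n)} =
            {c \<cdot>\<^sub>v ((1 / sqrt (real n)) \<cdot>\<^sub>v ones_vec n) | c. c \<noteq> 0})) \<and>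
     ((\<forall>\<alpha>. x \<noteq> \<alpha> \<cdot>\<^sub>v ones_vec n) \<longrightarrow>
        {k. eigenvalue (A_mat \<rho> x) k \<and> k > 0} = {2 * real n - alpha_lower \<rho> x} \<and>
        {k. eigenvalue (A_mat \<rho> x) k \<and> k < 0} = {2 * real n - alpha_upper \<rho> x} \<and>
        {v. eigenvector (A_mat \<rho> x) v (2 * real n - alpha_lower \<rho> x)} =
          {c \<cdot>\<^sub>v (x - (alpha_upper \<rho> x / (\<rho> * l1_norm x)) \<cdot>\<^sub>v ones_vec n) | c. c \<noteq> 0} \<and>
        {v. eigenvector (A_mat \<rho> x) v (2 * real n - alpha_upper \<rho> x)} =
          {c \<cdot>\<^sub>v (x - (alpha_lower \<rho> x / (\<rho> * l1_norm x)) \<cdot>\<^sub>v ones_vec n) | c. c \<noteq> 0})"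
proof (intro conjI allI impI)
  fix \<alpha> :: real assume "\<alpha> > 0" and x: "x = \<alpha> \<cdot>\<^sub>v ones_vec n" and r: "\<rho> * \<alpha>\<^sup>2 = 2"
  \<comment> \<open>The factor \<open>2 - \<rho> * \<alpha>\<^sup>2\<close> vanishes, so any nonzero
    vector would serve.\<close>
  have "eigenvector (A_mat \<rho> x) (ones_vec n) 0"
    unfolding eigenvector_A_mat_const_iff[OF assms(1) x] using r assms(1)
    by (auto simp: ones_vec_def vec_eq_iff)
  then have "eigenvalue (A_mat \<rho> x) 0" unfolding eigenvalue_def by blast
  moreover have "k = 0" if "eigenvalue (A_mat \<rho> x) k" for k
    using that r eigenvector_A_mat_const_nonzero_iff[OF assms(1) x, of k \<rho>]
    unfolding eigenvalue_def by auto
  ultimately show "{k. eigenvalue (A_mat \<rho> x) k} = {0}" by blast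
next
  fix \<alpha> :: real assume "\<alpha> > 0" and x: "x = \<alpha> \<cdot>\<^sub>v ones_vec n" and r: "\<rho> * \<alpha>\<^sup>2 \<noteq> 2"
  define l where "l = (2 - \<rho> * \<alpha>\<^sup>2) * real n"
  have l: "l \<noteq> 0" using r assms(1) by (simp add: l_def)
  note iff = eigenvector_A_mat_const_nonzero_iff[OF assms(1) x, of _ \<rho>, folded l_def]
  show "{k. eigenvalue (A_mat \<rho> x) k \<and> k \<noteq> 0} = {(2 - \<rho> * \<alpha>\<^sup>2) * real n}"
    unfolding l_def[symmetric] eigenvalue_def using iff l by (auto intro!: exI[of _ 1])
  have "(\<exists>c. c \<noteq> 0 \<and> v = c \<cdot>\<^sub>v ones_vec n) \<longleftrightarrow>
      (\<exists>c. v = c \<cdot>\<^sub>v ((1 / sqrt (real n)) \<cdot>\<^sub>v ones_vec n) \<and> c \<noteq> 0)" for v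
  proof
    assume "\<exists>c. c \<noteq> 0 \<and> v = c \<cdot>\<^sub>v ones_vec n"
    then obtain c where "c \<noteq> 0" "v = c \<cdot>\<^sub>v ones_vec n" by blast
    then show "\<exists>c. v = c \<cdot>\<^sub>v ((1 / sqrt (real n)) \<cdot>\<^sub>v ones_vec n) \<and> c \<noteq> 0"
      using assms(1) by (intro exI[of _ "c * sqrt (real n)"]) (simp add: smult_smult_assoc)
  next
    assume "\<exists>c. v = c \<cdot>\<^sub>v ((1 / sqrt (real n)) \<cdot>\<^sub>v ones_vec n) \<and> c \<noteq> 0"
    then obtain c where "c \<noteq> 0" "v = c \<cdot>\<^sub>v ((1 / sqrt (real n)) \<cdot>\<^sub>v ones_vec n)" by blast
    then show "\<exists>c. c \<noteq> 0 \<and> v = c \<cdot>\<^sub>v ones_vec n"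
      using assms(1) by (intro exI[of _ "c / sqrt (real n)"]) (simp add: smult_smult_assoc)
  qed
  then show "{v. eigenvector (A_mat \<rho> x) v ((2 - \<rho> * \<alpha>\<^sup>2) * real n)} =
      {c \<cdot>\<^sub>v ((1 / sqrt (real n)) \<cdot>\<^sub>v ones_vec n) | c. c \<noteq> 0}"
    unfolding l_def[symmetric] using iff[OF l] by auto
next
  assume nc: "\<forall>\<alpha>. x \<noteq> \<alpha> \<cdot>\<^sub>v ones_vec n"
  define s where "s = (\<Sum>i<n. x $ i)"
  define q where "q = (\<Sum>i<n. (x $ i)\<^sup>2)"
  define k1 where "k1 = 2 * real n - alpha_lower \<rho> x"
  define k2 where "k2 = 2 * real n - alpha_upper \<rho> x"
  define d where "d = sqrt (Delta \<rho> x)"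
  have dim: "dim_vec x = n" using assms(3) by simp
  \<comment> \<open>Nonnegativity of the entries turns the norm into the plain sum that the
    eigenvector equation contains.\<close>
  have l1: "l1_norm x = s" using assms(4) by (simp add: l1_norm_def s_def dim)
  have l2: "(l2_norm x)\<^sup>2 = q" by (simp add: l2_norm_def q_def dim sum_nonneg)
  have Delta: "Delta \<rho> x = (\<rho> / 2 * q + real n)\<^sup>2 - 2 * \<rho> * s\<^sup>2"
    by (simp add: Delta_def l1 l2 dim)
  have "\<nexists>\<alpha>. \<forall>i<n. x $ i = \<alpha>"
  proof
    assume "\<exists>\<alpha>. \<forall>i<n. x $ i = \<alpha>"
    then obtain \<alpha> where "\<forall>i<n. x $ i = \<alpha>" by blast
    then have "x = \<alpha> \<cdot>\<^sub>v ones_vec n" by (intro eq_vecI) (auto simp: ones_vec_def dim)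
    with nc show False by blast
  qed
  then have cs: "s\<^sup>2 < real n * q"
    unfolding s_def q_def by (rule sum_power2_less_if_not_constant[OF assms(1)])
  \<comment> \<open>A zero sum of nonnegative entries would force \<open>x = 0\<close>, hence
    \<open>q = 0\<close>, against the strict inequality \<open>cs\<close>.\<close>
  have s0: "s \<noteq> 0"
  proof
    assume "s = 0"
    then have "\<forall>i\<in>{..<n}. x $ i = 0"
      unfolding s_def using assms(4) by (subst (asm) sum_nonneg_eq_0_iff) auto
    then have "q = 0" by (simp add: q_def)
    with cs \<open>s = 0\<close> show False by simp
  qed
  \<comment> \<open>This form exposes the signs: \<open>k1\<close> and \<open>k2\<close> are
    \<open>real n - \<rho> / 2 * q\<close> plus and minus \<open>d\<close>, and \<open>cs\<close>
    makes \<open>d\<close> exceed the absolute value of that midpoint.\<close>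
  have Delta': "Delta \<rho> x = (real n - \<rho> / 2 * q)\<^sup>2 + 2 * \<rho> * (real n * q - s\<^sup>2)"
    unfolding Delta by (simp add: power2_eq_square algebra_simps)
  have "2 * \<rho> * (real n * q - s\<^sup>2) > 0" using cs assms(2) by simp
  then have "(real n - \<rho> / 2 * q)\<^sup>2 < Delta \<rho> x" unfolding Delta' by simp
  then have "\<bar>real n - \<rho> / 2 * q\<bar> < d"
    unfolding d_def by (metis real_sqrt_abs real_sqrt_less_iff)
  moreover have lo: "alpha_lower \<rho> x = \<rho> / 2 * q + real n - d"
    and up: "alpha_upper \<rho> x = \<rho> / 2 * q + real n + d"
    by (simp_all add: alpha_lower_def alpha_upper_def l2 dim d_def)
  ultimately have k1: "k1 > 0" and k2: "k2 < 0" by (auto simp: k1_def k2_def abs_less_iff)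
  \<comment> \<open>Adding \<open>\<rho> * q\<close> swaps the roles of the two alphas, which is why
    each eigenvector carries the alpha that its eigenvalue does not.\<close>
  have a1: "k1 + \<rho> * q = alpha_upper \<rho> x" and a2: "k2 + \<rho> * q = alpha_lower \<rho> x"
    by (simp_all add: k1_def k2_def lo up)
  have "Delta \<rho> x \<ge> 0" using \<open>(real n - \<rho> / 2 * q)\<^sup>2 < Delta \<rho> x\<close>
    by (meson less_imp_le order_trans zero_le_power2)
  then have d2: "2 * \<rho> * s\<^sup>2 = (\<rho> / 2 * q + real n)\<^sup>2 - d\<^sup>2" by (simp add: d_def Delta)
  \<comment> \<open>Factorization of the quadratic at its two roots, with \<open>p\<close> for
    \<open>\<rho> / 2 * q\<close> and \<open>m\<close> for \<open>real n\<close>.\<close>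
  have "(k + 2 * p) * (2 * m - k) - ((p + m)\<^sup>2 - d\<^sup>2) =
      - ((k - (2 * m - (p + m - d))) * (k - (2 * m - (p + m + d))))" for k p m :: real
    by (simp add: power2_eq_square algebra_simps)
  from this[of _ "\<rho> / 2 * q" "real n"]
  have "(k + \<rho> * q) * (2 * real n - k) - 2 * \<rho> * s\<^sup>2 = - ((k - k1) * (k - k2))" for k
    unfolding d2 k1_def k2_def lo up by simp
  then have "(k + \<rho> * q) * (2 * real n - k) = 2 * \<rho> * s\<^sup>2 \<longleftrightarrow> k = k1 \<or> k = k2" for k
    by (metis eq_iff_diff_eq_0 mult_eq_0_iff neg_equal_0_iff_equal)
  then have iff: "eigenvector (A_mat \<rho> x) v k \<longleftrightarrow> (k = k1 \<or> k = k2) \<and>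
      (\<exists>c. c \<noteq> 0 \<and> v = c \<cdot>\<^sub>v (x - ((k + \<rho> * q) / (\<rho> * s)) \<cdot>\<^sub>v ones_vec n))"
    if "k \<noteq> 0" for k v
    using eigenvector_A_mat_nonconst_iff[OF assms(3) _ s_def s0 q_def _ that, of \<rho> v] nc assms(2)
    by simp
  \<comment> \<open>The choice \<open>c = 1\<close> always provides an eigenvector, so only the
    condition on \<open>k\<close> survives.\<close>
  have ev: "eigenvalue (A_mat \<rho> x) k \<longleftrightarrow> k = k1 \<or> k = k2" if "k \<noteq> 0" for k
    unfolding eigenvalue_def iff[OF that] by (metis zero_neq_one)
  show "{k. eigenvalue (A_mat \<rho> x) k \<and> k > 0} = {2 * real n - alpha_lower \<rho> x}"
    using ev k1 k2 unfolding k1_def[symmetric] by force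
  show "{k. eigenvalue (A_mat \<rho> x) k \<and> k < 0} = {2 * real n - alpha_upper \<rho> x}"
    using ev k1 k2 unfolding k2_def[symmetric] by force
  show "{v. eigenvector (A_mat \<rho> x) v (2 * real n - alpha_lower \<rho> x)} =
      {c \<cdot>\<^sub>v (x - (alpha_upper \<rho> x / (\<rho> * l1_norm x)) \<cdot>\<^sub>v ones_vec n) | c. c \<noteq> 0}"
    unfolding k1_def[symmetric] l1 a1[symmetric] using iff[of k1] k1 by auto
  show "{v. eigenvector (A_mat \<rho> x) v (2 * real n - alpha_upper \<rho> x)} =
      {c \<cdot>\<^sub>v (x - (alpha_lower \<rho> x / (\<rho> * l1_norm x)) \<cdot>\<^sub>v ones_vec n) | c. c \<noteq> 0}"
    unfolding k2_def[symmetric] l1 a2[symmetric] using iff[of k2] k2 by auto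
qed

end
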